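(* Let $(X,d)$ be a metric space, $Y$ a real vector space, $K\subset Y$ a convex cone, $H\subset K$ a nonempty $K$-convex set with $0\notin \mathrm{vcl}(H+K)$, $f:X\to 2^Y$ a set-valued map and $x_0\in X$. For any $x\in X$, put $$S(x):=\{x'\in X:\ f(x)\subset f(x')+d(x,x')H+K\}.$$ Suppose that the following conditions are satisfied: (i) $(X,d)$ is $S(x_0)$-dynamically complete; (ii) there exists $\epsilon>0$ such that $f(x_0)\not\subset f(S(x_0))+\epsilon H+K$; (iii) for any $x\in S(x_0)$, $S(x)$ is dynamically closed. Then there exists $\bar x\in X$ such that (a) $f(x_0)\subset f(\bar x)+d(x_0,\bar x)H+K$; (b) $f(\bar x)\not\subset f(x)+d(\bar x,x)H+K$ for all $x\in X\setminus\{\bar x\}$.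
   Context: $2^Y$ is the family of all subsets of $Y$; for $A\subset X$, $f(A)=\bigcup_{x\in A}f(x)$. For $A,B\subset Y$ and $\alpha\in\mathbb R$, $A+B=\{a+b:a\in A,b\in B\}$ and $\alpha A=\{\alpha a:a\in A\}$. A cone is a nonempty set $K\subset Y$ with $\alpha K\subset K$ for all $\alpha\ge 0$; it is a convex cone if also $K+K\subset K$. Cones are always assumed nontrivial: $K\ne\{0\}$ and $K\ne Y$. A set $H$ is $K$-convex if $H+K$ is convex. For nonempty $A\subset Y$, the vector closure is $\mathrm{vcl}(A)=\{y\in Y:\exists v\in Y,\ \exists \lambda_n\ge 0,\ \lambda_n\to 0 \text{ with } y+\lambda_n v\in A\ \forall n\in\mathbb N\}$. $S(x)$ is dynamically closed if whenever $(x_n)\subset S(x)$ is a sequence with $x_{n+1}\in S(x_n)$ for all $n$ and $x_n\to\bar x$ in $X$, then $\bar x\in S(x)$. $(X,d)$ is $S(x)$-dynamically complete if for any Cauchy sequence $(x_n)\subset S(x)$ with $x_{n+1}\in S(x_n)$ for all $n$, there exists $\bar x\in X$ with $x_n\to\bar x$. *)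

theory Defs
  imports "HOL-Analysis.Analysis"
begin

text \<open>
  Sums of sets are the pointwise (Minkowski) sums of \<^theory>\<open>HOL-Library.Set_Algebras\<close>.
  The multiple of a set by a scalar is the image of the set under scaling.
\<close>

definition K_convex :: "'b::real_vector set \<Rightarrow> 'b set \<Rightarrow> bool"
  where "K_convex K H \<longleftrightarrow> convex (H + K)"

definition vcl :: "'b::real_vector set \<Rightarrow> 'b set"
  where "vcl A = {y. \<exists>v. \<exists>l :: nat \<Rightarrow> real.
    (\<forall>n. 0 \<le> l n) \<and> l \<longlonglongrightarrow> 0 \<and> (\<forall>n. y + l n *\<^sub>R v \<in> A)}"

definition S_map ::
  "('a::metric_space \<Rightarrow> 'b::real_vector set) \<Rightarrow> 'b set \<Rightarrow> 'b set \<Rightarrow> 'a \<Rightarrow> 'a set"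
  where "S_map f H K x = {x'. f x \<subseteq> f x' + (*\<^sub>R) (dist x x') ` H + K}"

definition dynamically_closed :: "('a::metric_space \<Rightarrow> 'a set) \<Rightarrow> 'a \<Rightarrow> bool"
  where "dynamically_closed S x \<longleftrightarrow>
    (\<forall>s l. (\<forall>n. s n \<in> S x) \<and> (\<forall>n. s (Suc n) \<in> S (s n)) \<and> s \<longlonglongrightarrow> l \<longrightarrow> l \<in> S x)"

text \<open>Here the limit is only required to exist in the whole space, not in \<open>S x\<close>.\<close>

definition dynamically_complete :: "('a::metric_space \<Rightarrow> 'a set) \<Rightarrow> 'a \<Rightarrow> bool"
  where "dynamically_complete S x \<longleftrightarrow>
    (\<forall>s. Cauchy s \<and> (\<forall>n. s n \<in> S x) \<and> (\<forall>n. s (Suc n) \<in> S (s n)) \<longrightarrow> (\<exists>l. s \<longlonglongrightarrow> l))"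

end

theory Submission
  imports Defs
begin

text \<open>
  The sets \<open>S x\<close> are the sections of a preorder on the metric space: read \<open>x' \<in> S x\<close> as
  ``\<open>x'\<close> improves on \<open>x\<close> by at least \<open>dist x x'\<close> in the directions \<open>H\<close>''.  Two improvements compose
  because \<open>H + K\<close> is convex, so that \<open>a H + K\<close> and \<open>b H + K\<close> add up to a subset of
  \<open>(a + b) H + K\<close>; together with the triangle inequality this gives transitivity
  (\<open>S_map_trans\<close>).

  The same composition rule bounds the length of chains.  Along a chain \<open>x0, x1, x2, \<dots>\<close> with
  \<open>x(n+1) \<in> S (xn)\<close> the improvements add up to \<open>f x0 \<subseteq> f (xn) + L H + K\<close>, where \<open>L\<close> is the
  length of the chain up to \<open>xn\<close>.  If \<open>L \<ge> \<epsilon>\<close>, then \<open>f x0 \<subseteq> f (S x0) + \<epsilon> H + K\<close>, which is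
  excluded.  So the steps of every chain are summable and tend to zero.

  What remains is the purely metric principle of Dancs, Hegedus and Medvegyev
  (\<open>exists_minimal_of_vanishing_chains\<close>): a chain which always moves about as far as it can is
  Cauchy, its limit lies in all the sections \<open>S (xn)\<close>, and these shrink to a point, so that
  nothing but the limit itself can improve on the limit.
\<close>

section \<open>Minimal elements of preorders on metric spaces\<close>

text \<open>
  The supremum of \<open>dist x\<close> over \<open>A\<close> need not be attained and may be infinite.  An element within a
  factor two of it serves when it is finite; otherwise any element at distance at least 1 will
  do, because a sequence of vanishing steps meets that case only finitely often.
\<close>

lemma almost_farthest_point:
  fixes x :: "'a::metric_space"
  assumes "x \<in> A"
  obtains y where "y \<in> A" "\<And>z. z \<in> A \<Longrightarrow> dist x y < 1 \<Longrightarrow> dist x z \<le> 2 * dist x y"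
proof (cases "\<exists>y\<in>A. dist x y \<ge> 1")
  case True
  then show ?thesis using that by fastforce
next
  case False
  then have bdd: "bdd_above (dist x ` A)"
    by (intro bdd_aboveI2[where M = 1]) fastforce
  define r where "r = (SUP z\<in>A. dist x z)"
  have le_r: "dist x z \<le> r" if "z \<in> A" for z
    unfolding r_def using bdd that by (rule cSUP_upper2[OF _ _ order_refl])
  show ?thesis
  proof (cases "r > 0")
    case True
    then have "r / 2 < (SUP z\<in>A. dist x z)" by (simp add: r_def)
    then obtain y where y: "y \<in> A" "r / 2 < dist x y"
      using less_cSUP_iff[OF _ bdd] \<open>x \<in> A\<close> by blast
    show ?thesis
    proof (rule that[OF y(1)])
      show "dist x z \<le> 2 * dist x y" if "z \<in> A" for z
        using le_r[OF that] y(2) by linarith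
    qed
  next
    case False
    show ?thesis
    proof (rule that[OF \<open>x \<in> A\<close>])
      show "dist x z \<le> 2 * dist x x" if "z \<in> A" for z
        using order_trans[OF le_r[OF that], of 0] False by simp
    qed
  qed
qed

lemma chain_section:
  assumes refl: "\<And>x. x \<in> S x"
    and trans: "\<And>x y z. y \<in> S x \<Longrightarrow> z \<in> S y \<Longrightarrow> z \<in> S x"
    and chain: "\<And>n. s (Suc n) \<in> S (s n)"
    and "m \<le> n"
  shows "s n \<in> S (s m)"
  using \<open>m \<le> n\<close> by (induction n rule: dec_induct) (blast intro: refl trans chain)+

text \<open>
  This is Ekeland's argument with the function replaced by a preorder: only the vanishing of the
  steps along chains is used in place of a bound from below.
\<close>

proposition exists_minimal_of_vanishing_chains:
  fixes S :: "'a::metric_space \<Rightarrow> 'a set"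
  assumes refl: "\<And>x. x \<in> S x"
    and trans: "\<And>x y z. y \<in> S x \<Longrightarrow> z \<in> S y \<Longrightarrow> z \<in> S x"
    and vanish: "\<And>s. s 0 = x0 \<Longrightarrow> (\<And>n. s (Suc n) \<in> S (s n)) \<Longrightarrow>
                    (\<lambda>n. dist (s n) (s (Suc n))) \<longlonglongrightarrow> 0"
    and complete: "dynamically_complete S x0"
    and closed: "\<And>x. x \<in> S x0 \<Longrightarrow> dynamically_closed S x"
  obtains xbar where "xbar \<in> S x0" "S xbar \<subseteq> {xbar}"
proof -
  have "\<exists>y. y \<in> S x \<and> (\<forall>z\<in>S x. dist x y < 1 \<longrightarrow> dist x z \<le> 2 * dist x y)" for x
    using almost_farthest_point[OF refl[of x]] by metis
  then obtain g where g: "\<And>x. g x \<in> S x"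
    and far: "\<And>x z. z \<in> S x \<Longrightarrow> dist x (g x) < 1 \<Longrightarrow> dist x z \<le> 2 * dist x (g x)"
    by metis
  define s where "s n = (g ^^ n) x0" for n
  have s0: "s 0 = x0" and s_Suc: "s (Suc n) = g (s n)" for n
    by (simp_all add: s_def)
  have chain: "s (Suc n) \<in> S (s n)" for n
    by (simp add: s_Suc g)
  have in_section: "s n \<in> S (s m)" if "m \<le> n" for m n
    using refl trans chain that by (rule chain_section)
  have in_Sx0: "s n \<in> S x0" for n
    using in_section[of 0 n] by (simp add: s0)
  have step: "(\<lambda>n. dist (s n) (s (Suc n))) \<longlonglongrightarrow> 0"
    using s0 chain by (rule vanish)
  have shrink: "\<forall>\<^sub>F n in sequentially. \<forall>z\<in>S (s n). dist (s n) z < e" if "e > 0" for e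
  proof -
    have "\<forall>\<^sub>F n in sequentially. dist (s n) (s (Suc n)) < min 1 (e / 2)"
      using that by (intro order_tendstoD(2)[OF step]) simp
    then show ?thesis
    proof eventually_elim
      case (elim n)
      then show ?case using far[of _ "s n"] by (fastforce simp: s_Suc)
    qed
  qed
  have "Cauchy s"
  proof (rule metric_CauchyI)
    fix e :: real assume "e > 0"
    then obtain N where N: "\<And>z. z \<in> S (s N) \<Longrightarrow> dist (s N) z < e / 2"
      using shrink[of "e / 2"] by (auto simp: eventually_sequentially)
    have "dist (s m) (s n) < e" if "m \<ge> N" "n \<ge> N" for m n
      using N[OF in_section[OF that(1)]] N[OF in_section[OF that(2)]]
        dist_triangle3[of "s m" "s n" "s N"] by linarith
    then show "\<exists>M. \<forall>m\<ge>M. \<forall>n\<ge>M. dist (s m) (s n) < e" by blast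
  qed
  then obtain xbar where lim: "s \<longlonglongrightarrow> xbar"
    using complete in_Sx0 chain unfolding dynamically_complete_def by blast
  have bar: "xbar \<in> S (s n)" for n
  proof -
    have "(\<lambda>k. s (k + n)) \<longlonglongrightarrow> xbar"
      using lim by (rule LIMSEQ_ignore_initial_segment)
    moreover have "s (k + n) \<in> S (s n)" "s (Suc k + n) \<in> S (s (k + n))" for k
      using in_section chain by simp_all
    ultimately show ?thesis
      using closed[OF in_Sx0[of n]] unfolding dynamically_closed_def
      by (elim allE[where x = "\<lambda>k. s (k + n)"] allE[where x = xbar]) simp
  qed
  have "z = xbar" if z: "z \<in> S xbar" for z
  proof -
    have "s \<longlonglongrightarrow> z"
    proof (rule tendstoI)
      fix e :: real assume "e > 0"
      from shrink[OF this] show "\<forall>\<^sub>F n in sequentially. dist (s n) z < e"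
        by eventually_elim (use trans[OF bar z] in blast)
    qed
    then show ?thesis using lim by (rule LIMSEQ_unique)
  qed
  then show ?thesis using that[of xbar] bar[of 0] by (auto simp: s0)
qed

section \<open>Scaled directions modulo a cone\<close>

text \<open>
  The excess \<open>(b - a) h\<close> of a larger multiple lies in the cone, because \<open>h\<close> does.
\<close>

lemma scaled_plus_cone_antimono:
  assumes K: "convex_cone K" and "H \<subseteq> K" and "a \<le> b"
  shows "(*\<^sub>R) b ` H + K \<subseteq> (*\<^sub>R) a ` H + K"
proof
  fix y assume "y \<in> (*\<^sub>R) b ` H + K"
  then obtain h k where hk: "h \<in> H" "k \<in> K" and y: "y = b *\<^sub>R h + k"
    by (auto elim!: set_plus_elim)
  have "(b - a) *\<^sub>R h + k \<in> K"
    using hk assms by (intro convex_cone_add convex_cone_scaleR) auto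
  then have "a *\<^sub>R h + ((b - a) *\<^sub>R h + k) \<in> (*\<^sub>R) a ` H + K"
    using hk by (intro set_plus_intro) auto
  also have "a *\<^sub>R h + ((b - a) *\<^sub>R h + k) = y"
    by (simp add: y algebra_simps)
  finally show "y \<in> (*\<^sub>R) a ` H + K" .
qed

text \<open>
  If \<open>a + b > 0\<close>, the sum \<open>a h + b h'\<close> is \<open>a + b\<close> times a convex combination of \<open>h\<close> and \<open>h'\<close>, and by
  \<open>K\<close>-convexity that combination lies in \<open>H + K\<close>, if not in \<open>H\<close>.
\<close>

lemma scaled_plus_cone_add:
  assumes K: "convex_cone K" and conv: "K_convex K H" and a: "0 \<le> a" and b: "0 \<le> b"
  shows "((*\<^sub>R) a ` H + K) + ((*\<^sub>R) b ` H + K) \<subseteq> (*\<^sub>R) (a + b) ` H + K"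
proof
  fix y assume "y \<in> ((*\<^sub>R) a ` H + K) + ((*\<^sub>R) b ` H + K)"
  then obtain h k h' k' where hk: "h \<in> H" "k \<in> K" "h' \<in> H" "k' \<in> K"
    and y: "y = (a *\<^sub>R h + k) + (b *\<^sub>R h' + k')"
    by (auto elim!: set_plus_elim)
  have kk: "k + k' \<in> K" using hk K by (simp add: convex_cone_add)
  show "y \<in> (*\<^sub>R) (a + b) ` H + K"
  proof (cases "a + b = 0")
    case True
    then have "a = 0" "b = 0" using a b by auto
    then have "y = (a + b) *\<^sub>R h + (k + k')" by (simp add: y)
    then show ?thesis using hk kk by auto
  next
    case False
    then have pos: "a + b > 0" using a b by simp
    have "H \<subseteq> H + K"
      using set_zero_plus2[OF convex_cone_contains_0[OF K], of H] by (simp add: add.commute)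
    then have "(a / (a + b)) *\<^sub>R h + (b / (a + b)) *\<^sub>R h' \<in> H + K"
      using conv hk pos a b unfolding K_convex_def
      by (intro convexD) (auto simp: add_divide_distrib[symmetric])
    then obtain h'' k'' where h'': "h'' \<in> H" "k'' \<in> K"
      and eq: "(a / (a + b)) *\<^sub>R h + (b / (a + b)) *\<^sub>R h' = h'' + k''"
      by (auto elim!: set_plus_elim)
    have "a *\<^sub>R h + b *\<^sub>R h' = (a + b) *\<^sub>R ((a / (a + b)) *\<^sub>R h + (b / (a + b)) *\<^sub>R h')"
      using pos by (simp add: scaleR_right_distrib)
    then have "y = (a + b) *\<^sub>R h'' + ((a + b) *\<^sub>R k'' + (k + k'))"
      by (simp add: y eq scaleR_right_distrib algebra_simps)
    moreover have "(a + b) *\<^sub>R k'' + (k + k') \<in> K"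
      using h'' pos convex_cone_scaleR[OF K, of "a + b" k''] by (intro convex_cone_add[OF K _ kk]) auto
    ultimately show ?thesis using h'' by auto
  qed
qed

section \<open>The improvement preorder\<close>

lemma improvement_compose:
  assumes K: "convex_cone K" and conv: "K_convex K H" and a: "0 \<le> a" and b: "0 \<le> b"
    and AB: "A \<subseteq> B + (*\<^sub>R) a ` H + K" and BC: "B \<subseteq> C + (*\<^sub>R) b ` H + K"
  shows "A \<subseteq> C + (*\<^sub>R) (a + b) ` H + K"
proof -
  have "A \<subseteq> B + ((*\<^sub>R) a ` H + K)"
    using AB by (simp add: add.assoc)
  also have "\<dots> \<subseteq> C + (*\<^sub>R) b ` H + K + ((*\<^sub>R) a ` H + K)"
    using BC by (intro set_plus_mono2) auto
  also have "\<dots> = C + (((*\<^sub>R) a ` H + K) + ((*\<^sub>R) b ` H + K))"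
    by (simp add: ac_simps)
  also have "\<dots> \<subseteq> C + ((*\<^sub>R) (a + b) ` H + K)"
    using scaled_plus_cone_add[OF K conv a b] by (rule set_plus_mono2[OF order_refl])
  finally show ?thesis by (simp add: add.assoc)
qed

lemma improvement_antimono:
  assumes "convex_cone K" and "H \<subseteq> K" and "a \<le> b"
    and "A \<subseteq> B + (*\<^sub>R) b ` H + K"
  shows "A \<subseteq> B + (*\<^sub>R) a ` H + K"
  using assms(4) set_plus_mono2[OF order_refl scaled_plus_cone_antimono[OF assms(1-3)], of B]
  by (simp add: add.assoc)

lemma improvement_zero:
  assumes K: "convex_cone K" and "H \<noteq> {}"
  shows "A \<subseteq> A + (*\<^sub>R) 0 ` H + K"
proof -
  have "(*\<^sub>R) (0::real) ` H = {0}" using \<open>H \<noteq> {}\<close> by auto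
  then show ?thesis
    using set_zero_plus2[OF convex_cone_contains_0[OF K], of A]
    by (simp add: add.commute flip: set_zero)
qed

lemma S_map_refl:
  assumes "convex_cone K" and "H \<noteq> {}"
  shows "x \<in> S_map f H K x"
  using improvement_zero[OF assms] by (simp add: S_map_def)

lemma S_map_trans:
  assumes K: "convex_cone K" and "H \<subseteq> K" and conv: "K_convex K H"
    and "y \<in> S_map f H K x" and "z \<in> S_map f H K y"
  shows "z \<in> S_map f H K x"
proof -
  have "f x \<subseteq> f z + (*\<^sub>R) (dist x y + dist y z) ` H + K"
    using assms(4,5) unfolding S_map_def
    by (intro improvement_compose[OF K conv, where B = "f y"]) simp_all
  then show ?thesis
    using improvement_antimono[OF K \<open>H \<subseteq> K\<close> dist_triangle] unfolding S_map_def by blast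
qed

lemma improvement_along_chain:
  assumes K: "convex_cone K" and "H \<noteq> {}" and conv: "K_convex K H"
    and chain: "\<And>n. s (Suc n) \<in> S_map f H K (s n)"
  shows "f (s 0) \<subseteq> f (s n) + (*\<^sub>R) (\<Sum>i<n. dist (s i) (s (Suc i))) ` H + K"
proof (induction n)
  case 0
  show ?case using improvement_zero[OF K \<open>H \<noteq> {}\<close>] by simp
next
  case (Suc n)
  have "f (s n) \<subseteq> f (s (Suc n)) + (*\<^sub>R) (dist (s n) (s (Suc n))) ` H + K"
    using chain[of n] by (simp add: S_map_def)
  then show ?case
    using improvement_compose[OF K conv _ _ Suc.IH] by (simp add: sum_nonneg)
qed

text \<open>
  An element \<open>y\<close> of \<open>f x0\<close> outside \<open>f (S x0) + \<epsilon> H + K\<close> takes the place of a lower bound for an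
  objective function: a chain longer than \<open>\<epsilon>\<close> would bring \<open>y\<close> into that set.
\<close>

lemma chain_steps_vanish:
  assumes K: "convex_cone K" and "H \<noteq> {}" and "H \<subseteq> K" and conv: "K_convex K H"
    and bound: "\<not> f (s 0) \<subseteq> (\<Union>x\<in>S_map f H K (s 0). f x) + (*\<^sub>R) \<epsilon> ` H + K"
    and chain: "\<And>n. s (Suc n) \<in> S_map f H K (s n)"
  shows "(\<lambda>n. dist (s n) (s (Suc n))) \<longlonglongrightarrow> 0"
proof -
  have len: "(\<Sum>i<n. dist (s i) (s (Suc i))) \<le> \<epsilon>" for n
  proof (rule ccontr)
    assume "\<not> ?thesis"
    then have "\<epsilon> \<le> (\<Sum>i<n. dist (s i) (s (Suc i)))" by simp
    then have "f (s 0) \<subseteq> f (s n) + (*\<^sub>R) \<epsilon> ` H + K"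
      using improvement_along_chain[where s = s and f = f, OF K \<open>H \<noteq> {}\<close> conv chain]
      by (rule improvement_antimono[OF K \<open>H \<subseteq> K\<close>])
    moreover have "s n \<in> S_map f H K (s 0)"
      using S_map_refl[OF K \<open>H \<noteq> {}\<close>] S_map_trans[OF K \<open>H \<subseteq> K\<close> conv] chain le0
      by (rule chain_section[where S = "S_map f H K"])
    then have "f (s n) + (*\<^sub>R) \<epsilon> ` H + K
        \<subseteq> (\<Union>x\<in>S_map f H K (s 0). f x) + (*\<^sub>R) \<epsilon> ` H + K"
      by (intro set_plus_mono2) auto
    ultimately show False using bound by blast
  qed
  then have "summable (\<lambda>n. dist (s n) (s (Suc n)))"
    by (intro summableI_nonneg_bounded) auto
  then show ?thesis by (rule summable_LIMSEQ_zero)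
qed

theorem theorem5p3:
  fixes f :: "'a::metric_space \<Rightarrow> 'b::real_vector set"
    and H K :: "'b set"
    and x0 :: 'a
  assumes "convex_cone K" and "K \<noteq> {0}" and "K \<noteq> UNIV"
    and "H \<noteq> {}" and "H \<subseteq> K" and "K_convex K H"
    and "0 \<notin> vcl (H + K)"
    and "dynamically_complete (S_map f H K) x0"
    and "\<exists>\<epsilon>>0. \<not> f x0 \<subseteq> (\<Union>x\<in>S_map f H K x0. f x) + (*\<^sub>R) \<epsilon> ` H + K"
    and "\<forall>x\<in>S_map f H K x0. dynamically_closed (S_map f H K) x"
  shows "\<exists>xbar. f x0 \<subseteq> f xbar + (*\<^sub>R) (dist x0 xbar) ` H + K \<and>
    (\<forall>x. x \<noteq> xbar \<longrightarrow> \<not> f xbar \<subseteq> f x + (*\<^sub>R) (dist xbar x) ` H + K)"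
proof -
  note K = assms(1) and ne = assms(4) and sub = assms(5) and conv = assms(6)
  obtain \<epsilon> where \<epsilon>: "\<not> f x0 \<subseteq> (\<Union>x\<in>S_map f H K x0. f x) + (*\<^sub>R) \<epsilon> ` H + K"
    using assms(9) by blast
  obtain xbar where "xbar \<in> S_map f H K x0" "S_map f H K xbar \<subseteq> {xbar}"
  proof (rule exists_minimal_of_vanishing_chains[of "S_map f H K" x0])
    show "x \<in> S_map f H K x" for x
      using K ne by (rule S_map_refl)
    show "z \<in> S_map f H K x" if "y \<in> S_map f H K x" "z \<in> S_map f H K y" for x y z
      using K sub conv that by (rule S_map_trans)
    show "(\<lambda>n. dist (s n) (s (Suc n))) \<longlonglongrightarrow> 0"
      if "s 0 = x0" "\<And>n. s (Suc n) \<in> S_map f H K (s n)" for s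
      using chain_steps_vanish[where s = s and f = f, OF K ne sub conv _ that(2)] \<epsilon> that(1) by blast
  qed (use assms(8,10) in auto)
  then show ?thesis unfolding S_map_def by blast
qed

end
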